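(* The t-product of cubic matrices is associative: for all positive integers $m,n,p,q,s$ and all $A\in\mathbb{R}^{m\times n\times s}$, $B\in\mathbb{R}^{n\times p\times s}$, $X\in\mathbb{R}^{p\times q\times s}$, $$(A\star B)\star X=A\star(B\star X).$$
   Context: A cubic matrix $A=(a_{i,j,k})\in\mathbb{R}^{m\times n\times s}$ ($i\in[1,m]$, $j\in[1,n]$, $k\in[1,s]$) has frontal slices $A^{(k)}=(a_{i,j,k})_{i,j}\in\mathbb{R}^{m\times n}$, $k\in[1,s]$, and is identified with the $sm\times n$ block-column matrix with blocks $A^{(1)},\dots,A^{(s)}$ (top to bottom). Its block circulant matrix is $$\mathrm{bcirc}(A)=\begin{bmatrix} A^{(1)} & A^{(s)} & A^{(s-1)} & \cdots & A^{(2)} \\ A^{(2)} & A^{(1)} & A^{(s)} & \cdots & A^{(3)} \\ \vdots & & & \ddots & \vdots \\ A^{(s)} & A^{(s-1)} & A^{(s-2)} & \cdots & A^{(1)} \end{bmatrix}\in\mathbb{R}^{sm\times sn}.$$ For $A\in\mathbb{R}^{m\times n\times s}$, $B\in\mathbb{R}^{n\times p\times s}$ the t-product is $A\star B:=\mathrm{bcirc}(A)\,B$ (ordinary matrix product with the $sn\times p$ block column of $B$), an $sm\times p$ matrix identified with an element of $\mathbb{R}^{m\times p\times s}$. *)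

theory Defs
  imports "Jordan_Normal_Form.Matrix" "HOL-Library.FuncSet"
begin

text \<open>
  All indices are 0-based: the entry \<open>a\<^sub>i\<^sub>,\<^sub>j\<^sub>,\<^sub>k\<close> of a cubic matrix with
  \<open>1 \<le> i \<le> m\<close>, \<open>1 \<le> j \<le> n\<close>, \<open>1 \<le> k \<le> s\<close> is \<open>A (i - 1, j - 1, k - 1)\<close>. Cubic matrices are
  extensional functions (undefined outside the index box), so that equality of cubic matrices
  is equality of their entries.
\<close>

type_synonym cubic_mat = "nat \<times> nat \<times> nat \<Rightarrow> real"

definition cubic_index :: "nat \<Rightarrow> nat \<Rightarrow> nat \<Rightarrow> (nat \<times> nat \<times> nat) set" where
  "cubic_index m n s = {..<m} \<times> {..<n} \<times> {..<s}"

definition carrier_cubic :: "nat \<Rightarrow> nat \<Rightarrow> nat \<Rightarrow> cubic_mat set" where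
  "carrier_cubic m n s = cubic_index m n s \<rightarrow>\<^sub>E UNIV"

definition frontal_slice :: "nat \<Rightarrow> nat \<Rightarrow> cubic_mat \<Rightarrow> nat \<Rightarrow> real mat" where
  "frontal_slice m n A k = mat m n (\<lambda>(i, j). A (i, j, k))"

text \<open>
  The identification of \<open>m \<times> n \<times> s\<close> cubic matrices with \<open>sm \<times> n\<close> matrices and its inverse.
  Row \<open>r\<close> of a block column with blocks of height \<open>m\<close> is row \<open>r mod m\<close> of block \<open>r div m\<close>.
\<close>

definition block_col :: "nat \<Rightarrow> nat \<Rightarrow> nat \<Rightarrow> cubic_mat \<Rightarrow> real mat" where
  "block_col m n s A =
     mat (s * m) n (\<lambda>(r, j). frontal_slice m n A (r div m) $$ (r mod m, j))"

definition cubic_of_block_col :: "nat \<Rightarrow> nat \<Rightarrow> nat \<Rightarrow> real mat \<Rightarrow> cubic_mat" where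
  "cubic_of_block_col m n s M =
     restrict (\<lambda>(i, j, k). M $$ (k * m + i, j)) (cubic_index m n s)"

text \<open>
  The block in block row \<open>a\<close> and block column \<open>b\<close> of the block circulant matrix is the slice
  with index \<open>a - b\<close> modulo \<open>s\<close>; adding \<open>s\<close> first avoids truncated subtraction.
\<close>

definition bcirc :: "nat \<Rightarrow> nat \<Rightarrow> nat \<Rightarrow> cubic_mat \<Rightarrow> real mat" where
  "bcirc m n s A =
     mat (s * m) (s * n)
       (\<lambda>(r, c). frontal_slice m n A ((r div m + s - c div n) mod s) $$ (r mod m, c mod n))"

definition tprod :: "nat \<Rightarrow> nat \<Rightarrow> nat \<Rightarrow> nat \<Rightarrow> cubic_mat \<Rightarrow> cubic_mat \<Rightarrow> cubic_mat" where
  "tprod m n p s A B = cubic_of_block_col m p s (bcirc m n s A * block_col n p s B)"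

lemma block_col_row_less: "k * m + i < s * m" if "i < m" "k < s" for i k m s :: nat
proof -
  have "k * m + i < Suc k * m" using that by simp
  also have "\<dots> \<le> s * m" using that by (intro mult_le_mono1) simp
  finally show ?thesis .
qed

lemma block_col_carrier: "block_col m n s A \<in> carrier_mat (s * m) n"
  by (simp add: block_col_def)

lemma bcirc_carrier: "bcirc m n s A \<in> carrier_mat (s * m) (s * n)"
  by (simp add: bcirc_def)

lemma cubic_of_block_col_carrier: "cubic_of_block_col m n s M \<in> carrier_cubic m n s"
  by (auto simp: cubic_of_block_col_def carrier_cubic_def)

lemma cubic_of_block_col_block_col:
  assumes "A \<in> carrier_cubic m n s"
  shows "cubic_of_block_col m n s (block_col m n s A) = A"
proof (rule extensionalityI[of _ "cubic_index m n s"])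
  show "A \<in> extensional (cubic_index m n s)"
    using assms by (auto simp: carrier_cubic_def PiE_def)
qed (auto simp: cubic_of_block_col_def block_col_def frontal_slice_def cubic_index_def
       block_col_row_less)

lemma block_col_cubic_of_block_col:
  assumes "M \<in> carrier_mat (s * m) n"
  shows "block_col m n s (cubic_of_block_col m n s M) = M"
proof (rule eq_matI)
  fix r j assume "r < dim_row M" "j < dim_col M"
  then have *: "r < s * m" "j < n" using assms by auto
  then have "m > 0" by (cases m) auto
  moreover have "r div m < s" using * by (simp add: less_mult_imp_div_less)
  ultimately show "block_col m n s (cubic_of_block_col m n s M) $$ (r, j) = M $$ (r, j)"
    using * by (simp add: block_col_def frontal_slice_def cubic_of_block_col_def cubic_index_def)
qed (use assms in \<open>auto simp: block_col_def\<close>)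

lemma tprod_carrier: "tprod m n p s A B \<in> carrier_cubic m p s"
  by (simp add: tprod_def cubic_of_block_col_carrier)

end

theory Submission
  imports Defs
begin

text \<open>
  Entrywise, the t-product is a matrix product combined with a cyclic convolution in the third
  index. Associativity is then an exchange of sums together with the shift of the convolution
  variable by a fixed residue modulo \<open>s\<close>.
\<close>

text \<open>Since \<open>a + s - b\<close> lies strictly between 0 and \<open>2 * s\<close>,
  reducing it modulo \<open>s\<close> removes at most one \<open>s\<close>. The case split turns
  goals about cyclic differences into linear arithmetic.\<close>

lemma add_diff_mod_eq:
  fixes a b s :: nat
  assumes "a < s" "b < s"
  shows "(a + s - b) mod s = (if b \<le> a then a - b else a + s - b)"
proof (cases "b \<le> a")
  case True
  then have "a + s - b = (a - b) + s" by simp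
  then show ?thesis using True assms by (simp only: mod_add_self2) simp
qed (use assms in simp)

text \<open>Modulo \<open>s\<close> this is \<open>(a - b) - (c - b) = a - c\<close>. Both inner
  residues are below \<open>s\<close>, so the outer difference expands by the same case
  split.\<close>

lemma add_diff_mod_cancel:
  fixes a b c s :: nat
  assumes "a < s" "b < s" "c < s"
  shows "((a + s - b) mod s + s - (c + s - b) mod s) mod s = (a + s - c) mod s"
proof -
  have "(a + s - b) mod s < s" "(c + s - b) mod s < s"
    using assms by simp_all
  from add_diff_mod_eq[OF this] show ?thesis
    using assms by (auto simp: add_diff_mod_eq)
qed

text \<open>An injective map of a finite set into itself is onto.\<close>

lemma bij_betw_add_diff_mod:
  fixes b s :: nat
  assumes "b < s"
  shows "bij_betw (\<lambda>c. (c + s - b) mod s) {..<s} {..<s}"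
proof -
  have "inj_on (\<lambda>c. (c + s - b) mod s) {..<s}"
    using assms by (intro inj_onI) (auto simp: add_diff_mod_eq split: if_splits)
  moreover have "(\<lambda>c. (c + s - b) mod s) ` {..<s} \<subseteq> {..<s}"
    using assms by auto
  ultimately show ?thesis
    by (simp add: bij_betw_def endo_inj_surj)
qed

lemma sum_lessThan_mult:
  fixes f :: "nat \<Rightarrow> 'a::comm_monoid_add"
  shows "(\<Sum>r<s * n. f r) = (\<Sum>b<s. \<Sum>l<n. f (b * n + l))"
proof -
  have "sum f {b * n..<b * n + n} = (\<Sum>l<n. f (b * n + l))" for b
    using sum.shift_bounds_nat_ivl[of f 0 "b * n" n]
    by (simp add: atLeast0LessThan add.commute)
  then show ?thesis
    by (simp flip: sum.nat_group)
qed

text \<open>Row \<open>k * m + i\<close> of \<open>bcirc\<close> lies in block row \<open>k\<close>,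
  and column \<open>b * n + l\<close> in block column \<open>b\<close>, where the block is slice
  \<open>k - b\<close> modulo \<open>s\<close>. Splitting the column sum by blocks gives the
  convolution.\<close>

lemma tprod_entry:
  assumes "i < m" "j < p" "k < s"
  shows "tprod m n p s A B (i, j, k) =
    (\<Sum>b<s. \<Sum>l<n. A (i, l, (k + s - b) mod s) * B (l, j, b))"
proof -
  have row: "k * m + i < s * m"
    using assms by (simp add: block_col_row_less)
  have "tprod m n p s A B (i, j, k) = (bcirc m n s A * block_col n p s B) $$ (k * m + i, j)"
    using assms by (simp add: tprod_def cubic_of_block_col_def cubic_index_def)
  also have "\<dots> = (\<Sum>r<s * n. bcirc m n s A $$ (k * m + i, r) * block_col n p s B $$ (r, j))"
    using row assms
    by (simp add: bcirc_def block_col_def scalar_prod_def atLeast0LessThan)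
  also have "\<dots> = (\<Sum>b<s. \<Sum>l<n. bcirc m n s A $$ (k * m + i, b * n + l) *
      block_col n p s B $$ (b * n + l, j))"
    by (rule sum_lessThan_mult)
  also have "\<dots> = (\<Sum>b<s. \<Sum>l<n. A (i, l, (k + s - b) mod s) * B (l, j, b))"
    using row assms
    by (intro sum.cong refl)
       (simp add: bcirc_def block_col_def frontal_slice_def block_col_row_less)
  finally show ?thesis .
qed

lemma carrier_cubic_eqI:
  assumes "A \<in> carrier_cubic m n s" "B \<in> carrier_cubic m n s"
    and "\<And>i j k. i < m \<Longrightarrow> j < n \<Longrightarrow> k < s \<Longrightarrow> A (i, j, k) = B (i, j, k)"
  shows "A = B"
  using assms unfolding carrier_cubic_def
  by (intro PiE_ext[of A "cubic_index m n s" _ B]) (auto simp: cubic_index_def)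

theorem theorem7:
  fixes m n p q s :: nat and A B X :: cubic_mat
  assumes "m > 0" "n > 0" "p > 0" "q > 0" "s > 0"
    and "A \<in> carrier_cubic m n s"
    and "B \<in> carrier_cubic n p s"
    and "X \<in> carrier_cubic p q s"
  shows "tprod m p q s (tprod m n p s A B) X = tprod m n q s A (tprod n p q s B X)"
proof (rule carrier_cubic_eqI[OF tprod_carrier tprod_carrier])
  fix i j k assume ijk: "i < m" "j < q" "k < s"
  \<comment> \<open>Substitute \<open>(c + s - b) mod s\<close> for \<open>c\<close>; the index of
    \<open>A\<close> then no longer involves \<open>b\<close>.\<close>
  have shift: "(\<Sum>c<s. A (i, h, ((k + s - b) mod s + s - c) mod s) * B (h, l, c)) =
      (\<Sum>c<s. A (i, h, (k + s - c) mod s) * B (h, l, (c + s - b) mod s))"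
    if "b < s" for b h l
    using that ijk
    by (subst sum.reindex_bij_betw[OF bij_betw_add_diff_mod[OF that], symmetric])
       (simp add: add_diff_mod_cancel)
  have "tprod m p q s (tprod m n p s A B) X (i, j, k) =
      (\<Sum>b<s. \<Sum>l<p. (\<Sum>c<s. \<Sum>h<n.
        A (i, h, ((k + s - b) mod s + s - c) mod s) * B (h, l, c)) * X (l, j, b))"
    using ijk by (simp add: tprod_entry)
  also have "\<dots> = (\<Sum>b<s. \<Sum>l<p. (\<Sum>h<n. \<Sum>c<s.
        A (i, h, (k + s - c) mod s) * B (h, l, (c + s - b) mod s)) * X (l, j, b))"
    \<comment> \<open>The swap makes \<open>c\<close> the innermost variable, the form in which
      \<open>shift\<close> applies.\<close>
    by (subst sum.swap) (simp add: shift)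
  also have "\<dots> = (\<Sum>b<s. \<Sum>l<p. \<Sum>c<s. \<Sum>h<n.
        A (i, h, (k + s - c) mod s) * (B (h, l, (c + s - b) mod s) * X (l, j, b)))"
    by (subst sum.swap) (simp add: sum_distrib_right mult.assoc)
  also have "\<dots> = (\<Sum>b<s. \<Sum>c<s. \<Sum>h<n. \<Sum>l<p.
        A (i, h, (k + s - c) mod s) * (B (h, l, (c + s - b) mod s) * X (l, j, b)))"
    \<comment> \<open>For fixed \<open>b\<close>, the sum over \<open>l\<close> moves inward past
      \<open>c\<close>, then past \<open>h\<close>.\<close>
    by (rule sum.cong[OF refl], rule trans[OF sum.swap], rule sum.cong[OF refl], rule sum.swap)
  also have "\<dots> = (\<Sum>c<s. \<Sum>h<n. \<Sum>b<s. \<Sum>l<p.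
        A (i, h, (k + s - c) mod s) * (B (h, l, (c + s - b) mod s) * X (l, j, b)))"
    by (rule trans[OF sum.swap], rule sum.cong[OF refl], rule sum.swap)
  \<comment> \<open>With \<open>c\<close> and \<open>h\<close> outermost, the factor from
    \<open>A\<close> leaves the sums over \<open>b\<close> and \<open>l\<close>, and what remains is
    the entry of \<open>tprod n p q s B X\<close> at \<open>(h, j, c)\<close>.\<close>
  also have "\<dots> = tprod m n q s A (tprod n p q s B X) (i, j, k)"
    using ijk by (simp add: tprod_entry sum_distrib_left)
  finally show "tprod m p q s (tprod m n p s A B) X (i, j, k) =
      tprod m n q s A (tprod n p q s B X) (i, j, k)" .
qed

end
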